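(* Let $n\in\mathbb{N}$, $n\ge 2$. For all $a,b,c\in\mathbb{R}^n$ the following generalized Jacobi identity holds: $$M_n(a)^T(b\times_n c)+M_n(b)^T(c\times_n a)+M_n(c)^T(a\times_n b)=0,$$ or, equivalently, $$\mathfrak{A}_n(b\times_n c)\,a+\mathfrak{A}_n(c\times_n a)\,b+\mathfrak{A}_n(a\times_n b)\,c=0 .$$
   Context: Vectors are real column vectors. For $a\in\mathbb{R}^n$ write $a=(\overline a,\alpha_n)^T$ with $\overline a\in\mathbb{R}^{n-1}$, and similarly for $b$. The generalized cross product $\times_n:\mathbb{R}^n\times\mathbb{R}^n\to\mathbb{R}^{n(n-1)/2}$ is defined inductively for $n\ge2$ by $$\begin{pmatrix}\alpha_1\\ \alpha_2\end{pmatrix}\times_2\begin{pmatrix}\beta_1\\ \beta_2\end{pmatrix}=\alpha_1\beta_2-\alpha_2\beta_1,\qquad a\times_n b=\begin{pmatrix}\overline a\times_{n-1}\overline b\\ \beta_n\overline a-\alpha_n\overline b\end{pmatrix}.$$ Equivalently, its entries are $\alpha_i\beta_j-\alpha_j\beta_i$ for $i<j$, listed in the order $(i,j)=(1,2),(1,3),(2,3),(1,4),(2,4),(3,4),\ldots$. For $a\in\mathbb{R}^n$, $M_n(a)\in\mathbb{R}^{\frac{n(n-1)}{2}\times n}$ denotes the unique matrix with $M_n(a)\,b=a\times_n b$ for all $b\in\mathbb{R}^n$. Let $\mathfrak{so}(n)$ be the space of real skew-symmetric $n\times n$ matrices. The bijection $\mathfrak{A}_n:\mathbb{R}^{n(n-1)/2}\to\mathfrak{so}(n)$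 is the inverse of the map $(\alpha_{ij})\mapsto(\alpha_{12},\alpha_{13},\alpha_{23},\ldots,\alpha_{1n},\ldots,\alpha_{(n-1)n})^T$ on $\mathfrak{so}(n)$, which lists the strictly upper triangular entries $\alpha_{ij}$, $i<j$, in the order $(i,j)=(1,2),(1,3),(2,3),(1,4),(2,4),(3,4),\ldots$. *)

theory Defs
  imports "Jordan_Normal_Form.Matrix"
begin

text \<open>Vectors of \<open>\<real>\<^sup>n\<close> are elements of \<^term>\<open>carrier_vec n\<close>, with coordinates indexed from 0:
  the coordinate \<open>\<alpha>\<^sub>i\<close> is \<open>a $ (i - 1)\<close>. In \<open>gcross n\<close> the truncation of \<open>a\<close> to its
  leading \<open>n - 1\<close> coordinates is \<open>vec_first a (n - 1)\<close>. The values for \<open>n < 2\<close>, outside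
  the range of the definition, are the empty vector.\<close>

fun gcross :: "nat \<Rightarrow> real vec \<Rightarrow> real vec \<Rightarrow> real vec" where
  "gcross 0 a b = 0\<^sub>v 0"
| "gcross (Suc 0) a b = 0\<^sub>v 0"
| "gcross (Suc (Suc 0)) a b = vec_of_list [a $ 0 * b $ 1 - a $ 1 * b $ 0]"
| "gcross (Suc (Suc (Suc m))) a b =
     (let k = Suc (Suc m) in
       gcross k (vec_first a k) (vec_first b k)
         @\<^sub>v ((b $ k) \<cdot>\<^sub>v vec_first a k - (a $ k) \<cdot>\<^sub>v vec_first b k))"

definition gcross_mat :: "nat \<Rightarrow> real vec \<Rightarrow> real mat" where
  "gcross_mat n a = (THE M. M \<in> carrier_mat (n * (n - 1) div 2) n \<and>
     (\<forall>b \<in> carrier_vec n. M *\<^sub>v b = gcross n a b))"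

definition so :: "nat \<Rightarrow> real mat set" where
  "so n = {A \<in> carrier_mat n n. A\<^sup>T = - A}"

text \<open>The pairs \<open>i < j < n\<close> are listed column by column:
  \<open>(0,1), (0,2), (1,2), (0,3), (1,3), (2,3), \<dots>\<close>\<close>

definition pair_list :: "nat \<Rightarrow> (nat \<Rightarrow> nat \<Rightarrow> 'a) \<Rightarrow> 'a list" where
  "pair_list n f = concat (map (\<lambda>j. map (\<lambda>i. f i j) [0..<j]) [0..<n])"

definition upper_vec :: "nat \<Rightarrow> real mat \<Rightarrow> real vec" where
  "upper_vec n A = vec_of_list (pair_list n (\<lambda>i j. A $$ (i, j)))"

definition skew_of_vec :: "nat \<Rightarrow> real vec \<Rightarrow> real mat" where
  "skew_of_vec n = the_inv_into (so n) (upper_vec n)"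


text \<open>The remaining lemmas show that the definitions by \<^const>\<open>The\<close> and
  \<^const>\<open>the_inv_into\<close> are meaningful.\<close>

lemma pair_list_Suc: "pair_list (Suc n) f = pair_list n f @ map (\<lambda>i. f i n) [0..<n]"
  by (simp add: pair_list_def)

lemma pair_list_0: "pair_list 0 f = []"
  by (simp add: pair_list_def)

lemma length_pair_list: "length (pair_list n f) = n * (n - 1) div 2"
proof (induction n)
  case 0
  then show ?case by (simp add: pair_list_0)
next
  case (Suc n)
  have "Suc n * (Suc n - 1) = n * (n - 1) + n * 2"
    by (cases n) (simp_all add: algebra_simps)
  then show ?case by (simp add: pair_list_Suc Suc)
qed

lemma pair_list_cong:
  "(\<And>i j. i < j \<Longrightarrow> j < n \<Longrightarrow> f i j = g i j) \<Longrightarrow> pair_list n f = pair_list n g"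
  by (induction n) (simp_all add: pair_list_0 pair_list_Suc)

lemma pair_list_inject:
  "pair_list n f = pair_list n g \<Longrightarrow> i < j \<Longrightarrow> j < n \<Longrightarrow> f i j = g i j"
proof (induction n)
  case 0
  then show ?case by simp
next
  case (Suc n)
  have "pair_list n f = pair_list n g" "\<forall>i\<in>{0..<n}. f i n = g i n"
    using Suc.prems(1) by (auto simp: pair_list_Suc append_eq_append_conv length_pair_list)
  then show ?case using Suc by (cases "j = n") auto
qed

lemma pair_list_surj:
  "length xs = n * (n - 1) div 2 \<Longrightarrow> \<exists>f. pair_list n f = xs"
proof (induction n arbitrary: xs)
  case 0
  then show ?case by (simp add: pair_list_0)
next
  case (Suc n)
  define k where "k = n * (n - 1) div 2"
  have "Suc n * (Suc n - 1) = n * (n - 1) + n * 2"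
    by (cases n) (simp_all add: algebra_simps)
  then have len: "length xs = k + n" using Suc.prems by (simp add: k_def)
  then obtain f where f: "pair_list n f = take k xs"
    using Suc.IH[of "take k xs"] by (auto simp: k_def)
  define g where "g = (\<lambda>i j. if j = n then drop k xs ! i else f i j)"
  have "pair_list n g = take k xs"
    unfolding f[symmetric] by (rule pair_list_cong) (simp add: g_def)
  moreover have "map (\<lambda>i. g i n) [0..<n] = drop k xs"
    using len by (auto simp: g_def intro!: nth_equalityI)
  ultimately have "pair_list (Suc n) g = xs" by (simp add: pair_list_Suc)
  then show ?case by blast
qed

lemma map_pair_list: "map h (pair_list n f) = pair_list n (\<lambda>i j. h (f i j))"
  by (induction n) (simp_all add: pair_list_0 pair_list_Suc)

lemma so_index:
  assumes "A \<in> so n" "i < n" "j < n"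
  shows "A $$ (j, i) = - A $$ (i, j)"
proof -
  have A: "A \<in> carrier_mat n n" "A\<^sup>T = - A" using assms(1) by (auto simp: so_def)
  have "A\<^sup>T $$ (i, j) = (- A) $$ (i, j)" by (simp only: A(2))
  then show ?thesis using A(1) assms(2,3) by simp
qed

lemma bij_betw_upper_vec: "bij_betw (upper_vec n) (so n) (carrier_vec (n * (n - 1) div 2))"
proof (rule bij_betwI')
  fix A B assume A: "A \<in> so n" and B: "B \<in> so n"
  have "A = B" if eq: "upper_vec n A = upper_vec n B"
  proof (rule eq_matI)
    have pl: "pair_list n (\<lambda>i j. A $$ (i, j)) = pair_list n (\<lambda>i j. B $$ (i, j))"
      using arg_cong[OF eq, of list_of_vec] by (simp add: upper_vec_def list_vec)
    have up: "A $$ (i, j) = B $$ (i, j)" if "i < j" "j < n" for i j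
      using pair_list_inject[OF pl that] .
    fix i j assume "i < dim_row B" "j < dim_col B"
    then have ij: "i < n" "j < n" using B by (auto simp: so_def)
    consider "i < j" | "i = j" | "j < i" by linarith
    then show "A $$ (i, j) = B $$ (i, j)"
    proof cases
      case 1
      then show ?thesis using up ij by simp
    next
      case 2
      then show ?thesis using so_index[OF A ij] so_index[OF B ij] by simp
    next
      case 3
      then show ?thesis
        using so_index[OF A ij(2,1)] so_index[OF B ij(2,1)] up[OF 3 ij(1)] by simp
    qed
  qed (use A B in \<open>auto simp: so_def\<close>)
  then show "(upper_vec n A = upper_vec n B) = (A = B)" by blast
next
  fix A assume "A \<in> so n"
  show "upper_vec n A \<in> carrier_vec (n * (n - 1) div 2)"
    by (rule carrier_vecI) (simp add: upper_vec_def length_pair_list)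
next
  fix v :: "real vec" assume "v \<in> carrier_vec (n * (n - 1) div 2)"
  then have "length (list_of_vec v) = n * (n - 1) div 2" by simp
  then obtain f where f: "pair_list n f = list_of_vec v" using pair_list_surj by blast
  define A where "A = mat n n (\<lambda>(i, j). if i < j then f i j else if j < i then - f j i else 0)"
  have "A \<in> so n" by (auto simp: so_def A_def)
  moreover have "pair_list n (\<lambda>i j. A $$ (i, j)) = pair_list n f"
    by (rule pair_list_cong) (simp add: A_def)
  then have "v = upper_vec n A" by (simp add: upper_vec_def f vec_list)
  ultimately show "\<exists>A\<in>so n. v = upper_vec n A" by blast
qed

lemma vec_of_list_append: "vec_of_list (xs @ ys) = vec_of_list xs @\<^sub>v vec_of_list ys"
  by (rule eq_vecI) (auto simp: vec_of_list_index nth_append)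

lemma gcross_eq_pair_list:
  "gcross n a b = vec_of_list (pair_list n (\<lambda>i j. a $ i * b $ j - a $ j * b $ i))"
proof (induction n a b rule: gcross.induct)
  case (4 m a b)
  define k where "k = Suc (Suc m)"
  have "gcross k (vec_first a k) (vec_first b k) =
    vec_of_list (pair_list k (\<lambda>i j. a $ i * b $ j - a $ j * b $ i))"
    unfolding 4[OF k_def, folded k_def]
    by (rule arg_cong[of _ _ vec_of_list], rule pair_list_cong) (simp add: vec_first_def)
  moreover have "(b $ k) \<cdot>\<^sub>v vec_first a k - (a $ k) \<cdot>\<^sub>v vec_first b k =
    vec_of_list (map (\<lambda>i. a $ i * b $ k - a $ k * b $ i) [0..<k])"
    by (rule eq_vecI) (simp_all add: vec_first_def vec_of_list_index mult.commute)
  ultimately show ?case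
    unfolding gcross.simps Let_def
    unfolding k_def[symmetric] pair_list_Suc[of k] vec_of_list_append by (simp only:)
qed (auto simp: pair_list_def)

lemma gcross_carrier: "gcross n a b \<in> carrier_vec (n * (n - 1) div 2)"
  by (rule carrier_vecI) (simp add: gcross_eq_pair_list length_pair_list)

lemma ex1_gcross_mat:
  "\<exists>!M. M \<in> carrier_mat (n * (n - 1) div 2) n \<and> (\<forall>b \<in> carrier_vec n. M *\<^sub>v b = gcross n a b)"
proof (rule ex_ex1I)
  define r where "r = (\<lambda>i j. a $ i \<cdot>\<^sub>v unit_vec n j - a $ j \<cdot>\<^sub>v unit_vec n i :: real vec)"
  define M where "M = mat_of_rows n (pair_list n r)"
  have "M *\<^sub>v b = gcross n a b" if b: "b \<in> carrier_vec n" for b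
  proof -
    have "set (pair_list n r) \<subseteq> carrier_vec n"
      by (auto simp: pair_list_def r_def)
    then have "pair_list n r ! i \<in> carrier_vec n" if "i < length (pair_list n r)" for i
      using that nth_mem by blast
    then have "M *\<^sub>v b = vec_of_list (map (\<lambda>v. v \<bullet> b) (pair_list n r))"
      by (intro eq_vecI) (auto simp: M_def vec_of_list_index)
    also have "map (\<lambda>v. v \<bullet> b) (pair_list n r)
        = pair_list n (\<lambda>i j. a $ i * b $ j - a $ j * b $ i)"
      unfolding map_pair_list using b
      by (intro pair_list_cong) (simp add: r_def minus_scalar_prod_distrib[of _ n])
    finally show ?thesis by (simp add: gcross_eq_pair_list)
  qed
  moreover have "M \<in> carrier_mat (n * (n - 1) div 2) n"
    by (simp add: M_def length_pair_list carrier_matI)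
  ultimately show "\<exists>M. M \<in> carrier_mat (n * (n - 1) div 2) n \<and>
      (\<forall>b \<in> carrier_vec n. M *\<^sub>v b = gcross n a b)" by blast
next
  fix M N :: "real mat"
  assume M: "M \<in> carrier_mat (n * (n - 1) div 2) n \<and> (\<forall>b \<in> carrier_vec n. M *\<^sub>v b = gcross n a b)"
    and N: "N \<in> carrier_mat (n * (n - 1) div 2) n \<and> (\<forall>b \<in> carrier_vec n. N *\<^sub>v b = gcross n a b)"
  show "M = N"
  proof (rule eq_matI)
    fix i j assume ij: "i < dim_row N" "j < dim_col N"
    then have j: "j < n" using N by auto
    have entry: "(A *\<^sub>v unit_vec n j) $ i = A $$ (i, j)"
      if "A \<in> carrier_mat (n * (n - 1) div 2) n" for A :: "real mat"
    proof -
      have i: "i < dim_row A" and "row A i \<in> carrier_vec n" using that ij N by auto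
      then show ?thesis using that j by (simp add: scalar_prod_right_unit)
    qed
    have "(M *\<^sub>v unit_vec n j) $ i = (N *\<^sub>v unit_vec n j) $ i" using M N by simp
    then show "M $$ (i, j) = N $$ (i, j)" using entry[of M] entry[of N] M N by metis
  qed (use M N in auto)
qed

lemma gcross_mat_carrier: "gcross_mat n a \<in> carrier_mat (n * (n - 1) div 2) n"
  and gcross_mat_mult: "b \<in> carrier_vec n \<Longrightarrow> gcross_mat n a *\<^sub>v b = gcross n a b"
  using theI'[OF ex1_gcross_mat[of n a]] unfolding gcross_mat_def by blast+

lemma skew_of_vec_in_so: "v \<in> carrier_vec (n * (n - 1) div 2) \<Longrightarrow> skew_of_vec n v \<in> so n"
  and upper_vec_skew_of_vec:
    "v \<in> carrier_vec (n * (n - 1) div 2) \<Longrightarrow> upper_vec n (skew_of_vec n v) = v"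
  using bij_betw_upper_vec[of n]
  by (auto simp: skew_of_vec_def bij_betw_def the_inv_into_into f_the_inv_into_f)

end

theory Submission
  imports Defs
begin

text \<open>
  The skew-symmetric matrix with upper triangular entries \<open>b \<times>\<^sub>n c\<close> is
  \<open>b c\<^sup>T - c b\<^sup>T\<close> (\<open>skew_of_vec_gcross\<close>), so it maps \<open>a\<close> to
  \<open>(c \<bullet> a) b - (b \<bullet> a) c\<close>, the analogue of the Grassmann identity for the triple cross
  product. Summed over the cyclic permutations of \<open>a, b, c\<close>, each vector occurs twice, with
  opposite coefficients; this is the second identity.

  The first identity is the negative of the second, because
  \<open>M\<^sub>n(a)\<^sup>T v = - A\<^sub>n(v) a\<close> for every \<open>v\<close> (\<open>transpose_gcross_mat_mult\<close>), with
  \<open>A\<^sub>n(v)\<close> the skew-symmetric matrix of \<open>v\<close>. In terms of bilinear forms this says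
  \<open>v \<bullet> (a \<times>\<^sub>n x) = a \<bullet> A\<^sub>n(v) x\<close>: the sum over all index pairs on the right
  collapses, by skew symmetry, to the sum over \<open>i < j\<close> on the left
  (\<open>upper_vec_scalar_prod_gcross\<close>).
\<close>

lemma scalar_prod_pair_list:
  "vec_of_list (pair_list n f) \<bullet> vec_of_list (pair_list n g)
     = (\<Sum>j<n. \<Sum>i<j. f i j * g i j :: real)"
proof (induction n)
  case 0
  then show ?case by (simp add: pair_list_0 scalar_prod_def)
next
  case (Suc n)
  have carrier: "vec_of_list (pair_list n h) \<in> carrier_vec (n * (n - 1) div 2)"
    "vec_of_list (map (\<lambda>i. h i n) [0..<n]) \<in> carrier_vec n" for h :: "nat \<Rightarrow> nat \<Rightarrow> real"
    by (auto intro!: carrier_vecI simp: length_pair_list)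
  have "vec_of_list (map (\<lambda>i. f i n) [0..<n]) \<bullet> vec_of_list (map (\<lambda>i. g i n) [0..<n])
      = (\<Sum>i<n. f i n * g i n)"
    by (simp add: scalar_prod_def vec_of_list_index atLeast0LessThan)
  then show ?case
    unfolding pair_list_Suc vec_of_list_append
    by (subst scalar_prod_append[OF carrier(1) carrier(2) carrier(1) carrier(2)]) (simp add: Suc)
qed

lemma sum_square_off_diagonal:
  fixes h :: "nat \<Rightarrow> nat \<Rightarrow> 'a::comm_monoid_add"
  assumes "\<And>i. i < n \<Longrightarrow> h i i = 0"
  shows "(\<Sum>i<n. \<Sum>j<n. h i j) = (\<Sum>j<n. \<Sum>i<j. h i j + h j i)"
  using assms by (induction n) (simp_all add: sum.distrib ac_simps)

text \<open>Since \<open>upper_vec\<close> is injective on skew-symmetric matrices, it suffices that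
  the matrix \<open>b c\<^sup>T - c b\<^sup>T\<close> is skew-symmetric and has the right entries above
  the diagonal.\<close>

lemma skew_of_vec_gcross:
  "skew_of_vec n (gcross n b c) = mat n n (\<lambda>(i, j). b $ i * c $ j - b $ j * c $ i)"
    (is "_ = ?A")
  unfolding skew_of_vec_def
proof (rule the_inv_into_f_eq)
  show "inj_on (upper_vec n) (so n)"
    using bij_betw_upper_vec by (rule bij_betw_imp_inj_on)
  show "?A \<in> so n" by (auto simp: so_def)
  show "upper_vec n ?A = gcross n b c"
    unfolding upper_vec_def gcross_eq_pair_list
    by (rule arg_cong[of _ _ vec_of_list], rule pair_list_cong) simp
qed

lemma skew_of_vec_gcross_mult:
  assumes "a \<in> carrier_vec n" "b \<in> carrier_vec n" "c \<in> carrier_vec n"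
  shows "skew_of_vec n (gcross n b c) *\<^sub>v a = (c \<bullet> a) \<cdot>\<^sub>v b - (b \<bullet> a) \<cdot>\<^sub>v c"
proof (rule eq_vecI)
  fix i assume "i < dim_vec ((c \<bullet> a) \<cdot>\<^sub>v b - (b \<bullet> a) \<cdot>\<^sub>v c)"
  then have i: "i < n" using assms by simp
  have "(skew_of_vec n (gcross n b c) *\<^sub>v a) $ i
      = (\<Sum>j<n. c $ j * a $ j * b $ i - b $ j * a $ j * c $ i)"
    using assms i
    by (simp add: skew_of_vec_gcross scalar_prod_def atLeast0LessThan algebra_simps)
  also have "\<dots> = ((c \<bullet> a) \<cdot>\<^sub>v b - (b \<bullet> a) \<cdot>\<^sub>v c) $ i"
    using assms i
    by (simp add: scalar_prod_def atLeast0LessThan sum_subtractf sum_distrib_right)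
  finally show "(skew_of_vec n (gcross n b c) *\<^sub>v a) $ i
      = ((c \<bullet> a) \<cdot>\<^sub>v b - (b \<bullet> a) \<cdot>\<^sub>v c) $ i" .
qed (use assms in \<open>simp add: skew_of_vec_gcross\<close>)

text \<open>The diagonal of \<open>A\<close> vanishes, and the terms at \<open>(i, j)\<close> and \<open>(j, i)\<close> of the
  bilinear form \<open>a\<^sup>T A x\<close> combine into the entry of \<open>A\<close> at \<open>(i, j)\<close> times the
  corresponding coordinate of the cross product.\<close>

lemma upper_vec_scalar_prod_gcross:
  assumes A: "A \<in> so n" and a: "a \<in> carrier_vec n" and x: "x \<in> carrier_vec n"
  shows "upper_vec n A \<bullet> gcross n a x = a \<bullet> (A *\<^sub>v x)"
proof -
  have dim: "A \<in> carrier_mat n n" using A by (simp add: so_def)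
  have diag: "A $$ (i, i) = 0" if "i < n" for i
    using so_index[OF A that that] by simp
  have "a \<bullet> (A *\<^sub>v x) = (\<Sum>i<n. \<Sum>j<n. a $ i * A $$ (i, j) * x $ j)"
    using dim x by (simp add: scalar_prod_def atLeast0LessThan sum_distrib_left mult.assoc)
  also have "\<dots> = (\<Sum>j<n. \<Sum>i<j. a $ i * A $$ (i, j) * x $ j + a $ j * A $$ (j, i) * x $ i)"
    by (rule sum_square_off_diagonal) (simp add: diag)
  also have "\<dots> = (\<Sum>j<n. \<Sum>i<j. A $$ (i, j) * (a $ i * x $ j - a $ j * x $ i))"
  proof (intro sum.cong refl)
    fix i j assume "j \<in> {..<n}" "i \<in> {..<j}"
    then have "A $$ (j, i) = - A $$ (i, j)" by (intro so_index[OF A]) auto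
    then show "a $ i * A $$ (i, j) * x $ j + a $ j * A $$ (j, i) * x $ i
        = A $$ (i, j) * (a $ i * x $ j - a $ j * x $ i)"
      by (simp add: algebra_simps)
  qed
  finally show ?thesis
    by (simp add: upper_vec_def gcross_eq_pair_list scalar_prod_pair_list)
qed

text \<open>The previous lemma at \<open>x = e\<^sub>k\<close> gives the coordinate \<open>k\<close>: column \<open>k\<close> of
  the cross product matrix is \<open>a \<times>\<^sub>n e\<^sub>k\<close>. The sign comes from reading column \<open>k\<close> of a
  skew-symmetric matrix as a negated row.\<close>

lemma transpose_gcross_mat_mult:
  assumes a: "a \<in> carrier_vec n" and v: "v \<in> carrier_vec (n * (n - 1) div 2)"
  shows "(gcross_mat n a)\<^sup>T *\<^sub>v v = - (skew_of_vec n v *\<^sub>v a)"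
proof (rule eq_vecI)
  define A where "A = skew_of_vec n v"
  have A: "A \<in> so n" and up: "upper_vec n A = v"
    using v by (simp_all add: A_def skew_of_vec_in_so upper_vec_skew_of_vec)
  have dim: "A \<in> carrier_mat n n" using A by (simp add: so_def)
  have M: "gcross_mat n a \<in> carrier_mat (n * (n - 1) div 2) n" by (rule gcross_mat_carrier)
  show "dim_vec ((gcross_mat n a)\<^sup>T *\<^sub>v v) = dim_vec (- (skew_of_vec n v *\<^sub>v a))"
    using M dim by (simp add: A_def)
  fix k assume "k < dim_vec (- (skew_of_vec n v *\<^sub>v a))"
  then have k: "k < n" using dim by (simp add: A_def)
  have col: "B *\<^sub>v unit_vec n k = col B k" if "B \<in> carrier_mat m n" for B :: "real mat" and m
    using that k by (intro eq_vecI) (auto simp: scalar_prod_right_unit[of _ n])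
  have "((gcross_mat n a)\<^sup>T *\<^sub>v v) $ k = col (gcross_mat n a) k \<bullet> v"
    using M k by simp
  also have "\<dots> = upper_vec n A \<bullet> gcross n a (unit_vec n k)"
    using col[OF M] gcross_mat_mult[of "unit_vec n k" n a]
      comm_scalar_prod[OF v gcross_carrier[of n a "unit_vec n k"]] by (simp add: up)
  also have "\<dots> = a \<bullet> col A k"
    using upper_vec_scalar_prod_gcross[OF A a, of "unit_vec n k"] col[OF dim] by simp
  also have "\<dots> = - (row A k \<bullet> a)"
    using a dim k
    by (simp add: scalar_prod_def so_index[OF A k] sum_negf mult.commute)
  also have "\<dots> = (- (A *\<^sub>v a)) $ k"
    using dim k by simp
  finally show "((gcross_mat n a)\<^sup>T *\<^sub>v v) $ k = (- (skew_of_vec n v *\<^sub>v a)) $ k"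
    by (simp add: A_def)
qed

theorem mainTheorem2:
  fixes n :: nat and a b c :: "real vec"
  assumes "n \<ge> 2"
    and "a \<in> carrier_vec n" and "b \<in> carrier_vec n" and "c \<in> carrier_vec n"
  shows "(gcross_mat n a)\<^sup>T *\<^sub>v gcross n b c
         + (gcross_mat n b)\<^sup>T *\<^sub>v gcross n c a
         + (gcross_mat n c)\<^sup>T *\<^sub>v gcross n a b = 0\<^sub>v n
       \<and> skew_of_vec n (gcross n b c) *\<^sub>v a
         + skew_of_vec n (gcross n c a) *\<^sub>v b
         + skew_of_vec n (gcross n a b) *\<^sub>v c = 0\<^sub>v n"
proof -
  note carrier = assms(2-4)
  have comm: "b \<bullet> a = a \<bullet> b" "c \<bullet> a = a \<bullet> c" "c \<bullet> b = b \<bullet> c"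
    using carrier by (simp_all add: comm_scalar_prod[of _ n])
  show ?thesis
    unfolding transpose_gcross_mat_mult[OF carrier(1) gcross_carrier]
      transpose_gcross_mat_mult[OF carrier(2) gcross_carrier]
      transpose_gcross_mat_mult[OF carrier(3) gcross_carrier]
      skew_of_vec_gcross_mult[OF carrier(1,2,3)] skew_of_vec_gcross_mult[OF carrier(2,3,1)]
      skew_of_vec_gcross_mult[OF carrier(3,1,2)] comm
    using carrier by (intro conjI eq_vecI) auto
qed

end
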